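(* Let $\mu,\nu\ge0$, $\lambda>0$, $n\in\mathbb N_0$ and $x>0$. Then $${}_0I_x^{\mu,\lambda}\mathcal L_n^{(-\nu,\lambda)}(x)=h_n^{\nu,-\mu}\,\mathcal L_n^{(-\nu-\mu,\lambda)}(x),$$ $${}_0D_x^{\mu,\lambda}\mathcal L_n^{(-\nu,\lambda)}(x)=h_n^{\nu,\mu}\,\mathcal L_n^{(\mu-\nu,\lambda)}(x)\qquad\text{if }\nu\ge\mu,$$ and $${}_0D_x^{\mu+k,\lambda}\mathcal L_n^{(-\mu,\lambda)}(x)=(-2\lambda)^k\,h_n^{\mu,\mu}\,\mathcal L_{n-k}^{(k,\lambda)}(x)\qquad\text{for } k\in\mathbb N_0,\ n\ge k.$$
   Context: $\mathbb N_0=\{0,1,2,\dots\}$. For $\alpha>-1$, $L_n^{(\alpha)}$ is the Laguerre polynomial $L_n^{(\alpha)}(x)=\frac{(\alpha+1)_n}{n!}\,{}_1F_1(-n;\alpha+1;x)$. The generalized Laguerre functions (GLFs) are, for $\alpha\in\mathbb R$, $\lambda>0$, $x>0$, $n\in\mathbb N_0$, $$\mathcal L_n^{(\alpha,\lambda)}(x)=\begin{cases}x^{-\alpha}e^{-\lambda x}L_n^{(-\alpha)}(2\lambda x),&\alpha<0,\\ e^{-\lambda x}L_n^{(\alpha)}(2\lambda x),&\alpha\ge0.\end{cases}$$ Set $h_n^{a,b}=\frac{\Gamma(n+1+a)}{\Gamma(n+1+a-b)}$. For $\mu>0$, ${}_0I_x^{\mu}u(x)=\frac1{\Gamma(\mu)}\int_0^x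 (x-y)^{\mu-1}u(y)\,dy$, with ${}_0I_x^0$ the identity; for $\mu\in[j-1,j)$, $j\ge1$ an integer, ${}_0D_x^{\mu}u=\frac{d^j}{dx^j}\,{}_0I_x^{j-\mu}u$ (Riemann–Liouville). The left tempered fractional integral and derivative on the half line are ${}_0I_x^{\mu,\lambda}u=e^{-\lambda x}\,{}_0I_x^{\mu}\{e^{\lambda x}u\}$ and ${}_0D_x^{\mu,\lambda}u=e^{-\lambda x}\,{}_0D_x^{\mu}\{e^{\lambda x}u\}$. *)

theory Defs
  imports "HOL-Analysis.Analysis"
begin

definition hyp_1F1 :: "real \<Rightarrow> real \<Rightarrow> real \<Rightarrow> real" where
  "hyp_1F1 a b x = eval_fps (fps_hypergeo [a] [b] 1) x"

text \<open>
  Only meant for \<open>a > -1\<close>; for other \<open>a\<close> the Pochhammer symbols in the denominators of the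
  series may vanish, and division by zero returns zero.
\<close>
definition Laguerre :: "nat \<Rightarrow> real \<Rightarrow> real \<Rightarrow> real" where
  "Laguerre n a x = pochhammer (a + 1) n / fact n * hyp_1F1 (- real n) (a + 1) x"

definition GLF :: "nat \<Rightarrow> real \<Rightarrow> real \<Rightarrow> real \<Rightarrow> real" where
  "GLF n a lam x =
     (if a < 0 then x powr (- a) * exp (- lam * x) * Laguerre n (- a) (2 * lam * x)
      else exp (- lam * x) * Laguerre n a (2 * lam * x))"

definition h_coeff :: "nat \<Rightarrow> real \<Rightarrow> real \<Rightarrow> real" where
  "h_coeff n a b = Gamma (real n + 1 + a) / Gamma (real n + 1 + a - b)"

text \<open>
  Riemann--Liouville operators based at \<open>0\<close>, for orders \<open>m \<ge> 0\<close> and points \<open>x > 0\<close>. Since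
  integrals and derivatives are total in HOL, with unspecified or default values when they do
  not exist, each operator comes with a predicate stating that its value is a genuine one.
  Integrating over the open interval means that \<open>u\<close> matters only on the open half line.
\<close>
definition RL_integrable :: "real \<Rightarrow> (real \<Rightarrow> real) \<Rightarrow> real \<Rightarrow> bool" where
  "RL_integrable m u x \<longleftrightarrow>
     m = 0 \<or> set_integrable lborel {0<..<x} (\<lambda>y. (x - y) powr (m - 1) * u y)"

definition RL_integral :: "real \<Rightarrow> (real \<Rightarrow> real) \<Rightarrow> real \<Rightarrow> real" where
  "RL_integral m u x =
     (if m = 0 then u x
      else 1 / Gamma m * (LINT y:{0<..<x}|lborel. (x - y) powr (m - 1) * u y))"

text \<open>The integer \<open>j \<ge> 1\<close> with \<open>m \<in> [j - 1, j)\<close>; an integer order \<open>m\<close> thus has \<open>j = m + 1\<close>.\<close>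
definition RL_ceil :: "real \<Rightarrow> nat" where
  "RL_ceil m = nat \<lfloor>m\<rfloor> + 1"

definition RL_differentiable :: "real \<Rightarrow> (real \<Rightarrow> real) \<Rightarrow> bool" where
  "RL_differentiable m u \<longleftrightarrow>
     (\<forall>x>0. RL_integrable (real (RL_ceil m) - m) u x \<and>
       (\<forall>i<RL_ceil m.
          (deriv ^^ i) (RL_integral (real (RL_ceil m) - m) u) field_differentiable at x))"

definition RL_deriv :: "real \<Rightarrow> (real \<Rightarrow> real) \<Rightarrow> real \<Rightarrow> real" where
  "RL_deriv m u = (deriv ^^ RL_ceil m) (RL_integral (real (RL_ceil m) - m) u)"

definition tempered_integrable :: "real \<Rightarrow> real \<Rightarrow> (real \<Rightarrow> real) \<Rightarrow> real \<Rightarrow> bool" where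
  "tempered_integrable m lam u x \<longleftrightarrow> RL_integrable m (\<lambda>y. exp (lam * y) * u y) x"

definition tempered_integral :: "real \<Rightarrow> real \<Rightarrow> (real \<Rightarrow> real) \<Rightarrow> real \<Rightarrow> real" where
  "tempered_integral m lam u x =
     exp (- lam * x) * RL_integral m (\<lambda>y. exp (lam * y) * u y) x"

definition tempered_differentiable :: "real \<Rightarrow> real \<Rightarrow> (real \<Rightarrow> real) \<Rightarrow> bool" where
  "tempered_differentiable m lam u \<longleftrightarrow> RL_differentiable m (\<lambda>y. exp (lam * y) * u y)"

definition tempered_deriv :: "real \<Rightarrow> real \<Rightarrow> (real \<Rightarrow> real) \<Rightarrow> real \<Rightarrow> real" where
  "tempered_deriv m lam u x =
     exp (- lam * x) * RL_deriv m (\<lambda>y. exp (lam * y) * u y) x"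

end

theory Submission
  imports Defs
begin

text \<open>
  The normalised powers \<open>E\<^sub>s(x) = x\<^sup>s / \<Gamma>(s + 1)\<close> turn Riemann--Liouville calculus into a shift of
  the exponent: Euler's Beta integral gives \<open>I\<^sup>\<mu> E\<^sub>s = E\<^bsub>s+\<mu>\<^esub>\<close> for \<open>s > -1\<close>, and the functional
  equation of \<open>\<Gamma>\<close> gives \<open>E\<^sub>s' = E\<^bsub>s-1\<^esub>\<close>. Reading the reciprocal \<open>1 / \<Gamma>\<close> as an entire function makes
  the second rule hold for every real \<open>s\<close>, including the exponents \<open>0, -1, -2, \<dots>\<close>, where \<open>E\<^bsub>s-1\<^esub>\<close>
  vanishes. Together the rules give \<open>D\<^sup>\<mu> E\<^sub>s = E\<^bsub>s-\<mu>\<^esub>\<close>, and they extend linearly to the finite sums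
  \<open>\<Sum>\<^sub>i c\<^sub>i E\<^bsub>s+i\<^esub>\<close>, whose coefficients they leave alone.

  A Laguerre function is such a sum. After multiplication by \<open>e\<^bsup>\<lambda>x\<^esup>\<close>, which is exactly what tempering
  does, the function with index \<open>-a \<le> 0\<close> becomes
  \<open>\<Gamma>(n+1+a) / n! \<cdot> \<Sum>\<^sub>i c\<^sub>i E\<^bsub>a+i\<^esub>(x)\<close> with \<open>c\<^sub>i = (-n)\<^sub>i (2\<lambda>)\<^sup>i / i!\<close> independent of \<open>a\<close>
  (lemma \<open>exp_times_GLF\<close>). Shifting \<open>a\<close> by \<open>\<mu>\<close> in either direction therefore only changes the
  prefactor, and the quotient of the two prefactors is the Gamma quotient \<open>h\<close>. For a derivative of
  order \<open>\<mu> + k\<close> of the function with index \<open>-\<mu>\<close> the sum starts at exponent \<open>-k\<close>; its first \<open>k\<close>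
  terms vanish and the remaining ones form the Laguerre polynomial of degree \<open>n - k\<close> and parameter
  \<open>k\<close> (lemma \<open>laguerre_sum_negative_exponent\<close>).
\<close>

section \<open>Normalised powers\<close>

text \<open>
  The factor \<open>rGamma (s + 1)\<close> is zero, as analytic continuation demands, when \<open>s\<close> is a negative
  integer.
\<close>
definition norm_power :: "real \<Rightarrow> real \<Rightarrow> real" where
  "norm_power s x = x powr s * rGamma (s + 1)"

definition power_sum :: "nat \<Rightarrow> (nat \<Rightarrow> real) \<Rightarrow> real \<Rightarrow> real \<Rightarrow> real" where
  "power_sum n c s x = (\<Sum>i\<le>n. c i * norm_power (s + real i) x)"

lemma power_sum_scale: "power_sum n (\<lambda>i. C * c i) s x = C * power_sum n c s x"
  by (simp add: power_sum_def sum_distrib_left mult.assoc)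

lemma norm_power_has_derivative:
  assumes "x > 0"
  shows "(norm_power s has_real_derivative norm_power (s - 1) x) (at x)"
proof -
  have "((\<lambda>x. x powr s * rGamma (s + 1)) has_real_derivative
          s * x powr (s - 1) * rGamma (s + 1)) (at x)"
    using assms by (auto intro!: derivative_eq_intros)
  moreover have "s * x powr (s - 1) * rGamma (s + 1) = norm_power (s - 1) x"
    using rGamma_plus1[of s] by (simp add: norm_power_def mult_ac)
  ultimately show ?thesis by (simp add: norm_power_def [abs_def])
qed

lemma power_sum_has_derivative:
  assumes "x > 0"
  shows "(power_sum n c s has_real_derivative power_sum n c (s - 1) x) (at x)"
proof -
  have "((\<lambda>x. \<Sum>i\<le>n. c i * norm_power (s + real i) x) has_real_derivative
          (\<Sum>i\<le>n. c i * norm_power (s + real i - 1) x)) (at x)"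
    using assms by (intro DERIV_sum DERIV_cmult norm_power_has_derivative) auto
  then show ?thesis
    by (simp add: power_sum_def [abs_def] algebra_simps)
qed

text \<open>
  A function that is a power sum only on the open half line has the expected iterated derivatives
  there, since differentiation is local.
\<close>
lemma iterated_deriv_power_sum:
  assumes f: "\<And>x. x > 0 \<Longrightarrow> f x = power_sum n c s x"
    and x: "x > 0"
  shows "(deriv ^^ i) f x = power_sum n c (s - real i) x"
    and "(deriv ^^ i) f field_differentiable at x"
proof -
  have transfer: "(g has_real_derivative power_sum n c (t - 1) y) (at y)"
    if "\<And>y. y > 0 \<Longrightarrow> g y = power_sum n c t y" "y > 0" for g t y
    using power_sum_has_derivative[OF that(2)] open_greaterThan[of "0::real"]
    by (rule has_field_derivative_transform_within_open) (use that in auto)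
  have iter: "(deriv ^^ i) f y = power_sum n c (s - real i) y" if "y > 0" for i y
    using that
  proof (induction i arbitrary: y)
    case 0
    then show ?case using f by simp
  next
    case (Suc i)
    have "((deriv ^^ i) f has_real_derivative power_sum n c (s - real i - 1) y) (at y)"
      using Suc by (intro transfer) auto
    then show ?case by (simp add: DERIV_imp_deriv algebra_simps)
  qed
  show "(deriv ^^ i) f x = power_sum n c (s - real i) x"
    by (rule iter[OF x])
  show "(deriv ^^ i) f field_differentiable at x"
    using transfer[OF iter x] unfolding field_differentiable_def by blast
qed

section \<open>Riemann--Liouville operators on power sums\<close>

text \<open>Euler's Beta integral, rescaled from the unit interval to \<open>(0, x)\<close> by \<open>y = x t\<close>.\<close>
lemma has_bochner_integral_Beta_scaled:
  fixes m s x :: real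
  assumes m: "m > 0" and s: "s > -1" and x: "x > 0"
  shows "has_bochner_integral lborel
           (\<lambda>y. indicator {0<..<x} y *\<^sub>R ((x - y) powr (m - 1) * y powr s))
           (x powr (s + m) * Beta (s + 1) m)"
proof -
  let ?f = "\<lambda>t::real. t powr (s + 1 - 1) * (1 - t) powr (m - 1)"
  let ?g = "\<lambda>t::real. indicator {0<..<1} t *\<^sub>R ?f t"
  have "set_integrable lborel {0..1} ?f"
    using integrable_Beta[of "s + 1" m] m s by simp
  then have int: "set_integrable lborel {0<..<1} ?f"
    by (rule set_integrable_subset) auto
  have "(?f has_integral Beta (s + 1) m) {0<..<1}"
    using has_integral_Beta_real[of "s + 1" m] m s by (simp add: has_integral_Icc_iff_Ioo)
  then have "(LINT t:{0<..<1}|lborel. ?f t) = Beta (s + 1) m"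
    using set_borel_integral_eq_integral(2)[OF int] by (simp add: integral_unique)
  then have "has_bochner_integral lborel ?g (Beta (s + 1) m)"
    using int by (simp add: has_bochner_integral_iff set_integrable_def set_lebesgue_integral_def)
  then have "has_bochner_integral lborel (\<lambda>y. ?g (0 + (1 / x) * y)) (Beta (s + 1) m /\<^sub>R \<bar>1 / x\<bar>)"
    using x by (subst lborel_has_bochner_integral_real_affine_iff[symmetric]) auto
  then have "has_bochner_integral lborel (\<lambda>y. x powr (s + m - 1) * ?g (0 + (1 / x) * y))
               (x powr (s + m - 1) * (Beta (s + 1) m /\<^sub>R \<bar>1 / x\<bar>))"
    by (rule has_bochner_integral_mult_right)
  moreover have "x powr (s + m - 1) * ?g (0 + (1 / x) * y)
      = indicator {0<..<x} y *\<^sub>R ((x - y) powr (m - 1) * y powr s)" for y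
  proof (cases "y \<in> {0<..<x}")
    case True
    have "x - y = x * (1 - y / x)"
      using x by (simp add: field_simps)
    then have "(x - y) powr (m - 1) = x powr (m - 1) * (1 - y / x) powr (m - 1)"
      using True x by (simp only: powr_mult)
    moreover have "y powr s = x powr s * (y / x) powr s"
      using True x by (subst powr_mult[symmetric]) auto
    moreover have "x powr (s + m - 1) = x powr s * x powr (m - 1)"
      using x by (simp add: powr_add[symmetric] algebra_simps)
    ultimately show ?thesis using True x by simp
  next
    case False
    then show ?thesis using x by (auto simp: indicator_def field_simps)
  qed
  moreover have "x powr (s + m - 1) * (Beta (s + 1) m /\<^sub>R \<bar>1 / x\<bar>)
      = x powr (s + m) * Beta (s + 1) m"
    using x by (simp add: powr_diff)
  ultimately show ?thesis by (simp only:)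
qed

lemma has_bochner_integral_norm_power:
  fixes m s x :: real
  assumes m: "m > 0" and s: "s > -1" and x: "x > 0"
  shows "has_bochner_integral lborel
           (\<lambda>y. indicator {0<..<x} y *\<^sub>R ((x - y) powr (m - 1) * norm_power s y))
           (Gamma m * norm_power (s + m) x)"
proof -
  have B: "has_bochner_integral lborel
          (\<lambda>y. rGamma (s + 1) * (indicator {0<..<x} y *\<^sub>R ((x - y) powr (m - 1) * y powr s)))
          (rGamma (s + 1) * (x powr (s + m) * Beta (s + 1) m))"
    by (rule has_bochner_integral_mult_right[OF has_bochner_integral_Beta_scaled[OF assms]])
  have "Gamma (s + 1) > 0"
    using s by (intro Gamma_real_pos) simp
  then have eq: "rGamma (s + 1) * (x powr (s + m) * Beta (s + 1) m) = Gamma m * norm_power (s + m) x"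
    by (simp add: Beta_altdef norm_power_def rGamma_inverse_Gamma field_simps)
  show ?thesis using B unfolding eq by (simp add: norm_power_def mult_ac)
qed

text \<open>
  The index law \<open>I\<^sup>m E\<^sub>s = E\<^bsub>s+m\<^esub>\<close>. The values of \<open>u\<close> outside the open half line do not enter, so \<open>u\<close>
  is only constrained there.
\<close>
lemma RL_integral_power_sum:
  assumes u: "\<And>y. y > 0 \<Longrightarrow> u y = power_sum n c s y"
    and m: "m \<ge> 0" and s: "s > -1" and x: "x > 0"
  shows "RL_integrable m u x" and "RL_integral m u x = power_sum n c (s + m) x"
proof -
  have "RL_integrable m u x \<and> RL_integral m u x = power_sum n c (s + m) x"
  proof (cases "m = 0")
    case True
    then show ?thesis using u x by (simp add: RL_integrable_def RL_integral_def)
  next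
    case False
    with m have m': "m > 0" by simp
    let ?E = "\<lambda>i y. indicator {0<..<x} y *\<^sub>R ((x - y) powr (m - 1) * norm_power (s + real i) y)"
    have "has_bochner_integral lborel (\<lambda>y. \<Sum>i\<le>n. c i * ?E i y)
            (\<Sum>i\<le>n. c i * (Gamma m * norm_power (s + real i + m) x))"
      using m' s x
      by (intro has_bochner_integral_sum has_bochner_integral_mult_right
            has_bochner_integral_norm_power) auto
    moreover have "(\<Sum>i\<le>n. c i * ?E i y) = indicator {0<..<x} y *\<^sub>R ((x - y) powr (m - 1) * u y)" for y
      using u[of y]
      by (auto simp: indicator_def power_sum_def sum_distrib_left mult_ac)
    moreover have "(\<Sum>i\<le>n. c i * (Gamma m * norm_power (s + real i + m) x))
        = Gamma m * power_sum n c (s + m) x"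
      by (simp add: power_sum_def sum_distrib_left mult_ac add_ac)
    ultimately have "has_bochner_integral lborel
        (\<lambda>y. indicator {0<..<x} y *\<^sub>R ((x - y) powr (m - 1) * u y))
        (Gamma m * power_sum n c (s + m) x)"
      by simp
    then show ?thesis
      using Gamma_real_pos[OF m'] False
      by (auto simp: RL_integrable_def RL_integral_def set_integrable_def
          set_lebesgue_integral_def has_bochner_integral_iff)
  qed
  then show "RL_integrable m u x" "RL_integral m u x = power_sum n c (s + m) x"
    by blast+
qed

text \<open>
  Integrating to order \<open>j - m\<close> raises the exponent to \<open>s + j - m\<close>, and the \<open>j\<close> derivatives bring it
  down to \<open>s - m\<close>. Only the integration needs \<open>s > -1\<close>, so \<open>s - m\<close> may be any real number.
\<close>
lemma RL_deriv_power_sum: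
  assumes u: "\<And>y. y > 0 \<Longrightarrow> u y = power_sum n c s y"
    and s: "s > -1"
  shows "RL_differentiable m u"
    and "x > 0 \<Longrightarrow> RL_deriv m u x = power_sum n c (s - m) x"
proof -
  define j where "j = RL_ceil m"
  have j: "real j - m \<ge> 0"
    unfolding j_def RL_ceil_def by linarith
  note I = RL_integral_power_sum[OF u j s]
  show "RL_differentiable m u"
    using I(1) iterated_deriv_power_sum(2)[OF I(2)]
    by (simp add: RL_differentiable_def j_def)
  show "RL_deriv m u x = power_sum n c (s - m) x" if "x > 0"
    using iterated_deriv_power_sum(1)[OF I(2) that, of j]
    by (simp add: RL_deriv_def j_def algebra_simps)
qed

section \<open>Laguerre functions as power sums\<close>

definition laguerre_coeff :: "nat \<Rightarrow> real \<Rightarrow> nat \<Rightarrow> real" where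
  "laguerre_coeff n lam i = pochhammer (- real n) i * (2 * lam) ^ i / fact i"

text \<open>
  The hypergeometric series terminates because \<open>(-n)\<^sub>i = 0\<close> for \<open>i > n\<close>, and the denominators
  \<open>(a+1)\<^sub>i\<close> combine with the prefactor through \<open>\<Gamma>(a+1+i) = (a+1)\<^sub>i \<Gamma>(a+1)\<close>.
\<close>
lemma Laguerre_eq_sum:
  assumes a: "a > -1"
  shows "Laguerre n a x = Gamma (real n + 1 + a) / fact n *
           (\<Sum>i\<le>n. pochhammer (- real n) i * x ^ i / fact i * rGamma (a + 1 + real i))"
proof -
  have "hyp_1F1 (- real n) (a + 1) x
      = (\<Sum>i. pochhammer (- real n) i / (pochhammer (a + 1) i * fact i) * x ^ i)"
    by (simp add: hyp_1F1_def eval_fps_def)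
  also have "\<dots> = (\<Sum>i\<le>n. pochhammer (- real n) i / (pochhammer (a + 1) i * fact i) * x ^ i)"
    by (rule suminf_finite) (auto simp: pochhammer_of_nat_eq_0_lemma)
  finally have F: "hyp_1F1 (- real n) (a + 1) x = \<dots>" .
  have pos: "Gamma (a + 1 + real i) > 0" for i
    using a by (intro Gamma_real_pos) simp
  have poch: "pochhammer (a + 1) i = rGamma (a + 1) / rGamma (a + 1 + real i)" for i
    using pochhammer_rGamma[of "a + 1" i] pos[of i]
    by (simp add: rGamma_inverse_Gamma field_simps)
  have nz: "rGamma (a + 1 + real i) \<noteq> 0" for i
    using pos[of i] by (simp add: rGamma_inverse_Gamma)
  have nz0: "rGamma (a + 1) \<noteq> 0"
    using nz[of 0] by simp
  have G: "Gamma (real n + 1 + a) = inverse (rGamma (a + 1 + real n))"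
    by (simp add: rGamma_inverse_Gamma add_ac)
  show ?thesis
    unfolding Laguerre_def F poch G sum_distrib_left
    by (intro sum.cong refl) (use nz nz0 in \<open>simp add: field_simps\<close>)
qed

text \<open>
  The factor \<open>y\<^sup>a\<close> of the Laguerre function raises the exponent \<open>i\<close> to \<open>a + i\<close>, which is exactly what
  matches the reciprocal \<open>1 / \<Gamma>(a + 1 + i)\<close> in the Laguerre polynomial.
\<close>
lemma exp_times_GLF:
  assumes a: "a \<ge> 0" and y: "y > 0"
  shows "exp (lam * y) * GLF n (- a) lam y
    = Gamma (real n + 1 + a) / fact n * power_sum n (laguerre_coeff n lam) a y"
proof -
  have "exp (lam * y) * GLF n (- a) lam y = y powr a * Laguerre n a (2 * lam * y)"
    using a y by (auto simp: GLF_def exp_minus field_simps)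
  also have "\<dots> = Gamma (real n + 1 + a) / fact n * (y powr a *
      (\<Sum>i\<le>n. pochhammer (- real n) i * (2 * lam * y) ^ i / fact i * rGamma (a + 1 + real i)))"
    using a by (subst Laguerre_eq_sum) auto
  also have "y powr a *
      (\<Sum>i\<le>n. pochhammer (- real n) i * (2 * lam * y) ^ i / fact i * rGamma (a + 1 + real i))
      = power_sum n (laguerre_coeff n lam) a y"
    unfolding power_sum_def sum_distrib_left laguerre_coeff_def norm_power_def
    using y by (intro sum.cong refl) (simp add: powr_add powr_realpow power_mult_distrib add_ac)
  finally show ?thesis .
qed

text \<open>
  At starting exponent \<open>-k\<close> the terms with \<open>i < k\<close> drop out, because \<open>1 / \<Gamma>\<close> vanishes at
  \<open>i - k + 1 \<le> 0\<close>. In the others, \<open>i = k + j\<close>, the factor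
  \<open>(-n)\<^bsub>k+j\<^esub> = (-1)\<^sup>k n! / (n-k)! \<cdot> (-(n-k))\<^sub>j\<close> lowers the degree, while the factorials
  \<open>i! = \<Gamma>(k + 1 + j)\<close> and \<open>\<Gamma>(i - k + 1) = j!\<close> exchange roles.
\<close>
lemma laguerre_sum_negative_exponent:
  assumes k: "k \<le> n" and y: "y > 0"
  shows "power_sum n (laguerre_coeff n lam) (- real k) y
    = (- 2 * lam) ^ k * Laguerre (n - k) (real k) (2 * lam * y)"
proof -
  let ?t = "\<lambda>i. laguerre_coeff n lam i * norm_power (- real k + real i) y"
  have zero: "?t i = 0" if "i < k" for i
  proof -
    have "- real k + real i + 1 = of_int (int i + 1 - int k)" by simp
    then have "rGamma (- real k + real i + 1) = 0"
      using that by (simp only: rGamma_of_int) simp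
    then show ?thesis by (simp add: norm_power_def)
  qed
  have "(\<Sum>i\<le>n. ?t i) = (\<Sum>i\<in>{k..n}. ?t i)"
    by (intro sum.mono_neutral_right ballI zero) auto
  also have "\<dots> = (\<Sum>j\<le>n - k. ?t (j + k))"
    using sum.shift_bounds_cl_nat_ivl[of ?t 0 k "n - k"] k by (simp add: atLeast0AtMost)
  also have "\<dots> = (\<Sum>j\<le>n - k. (- 2 * lam) ^ k * (fact n / fact (n - k) *
      (pochhammer (- real (n - k)) j * (2 * lam * y) ^ j / fact j * rGamma (real k + 1 + real j))))"
  proof (intro sum.cong refl)
    fix j
    have "pochhammer (- real n) k = (- 1) ^ k * (fact n / fact (n - k))"
      using k pochhammer_minus[of "real n" k] pochhammer_product[of "n - k" n "1 :: real"]
      by (simp add: pochhammer_fact [symmetric] of_nat_diff field_simps)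
    then have p: "pochhammer (- real n) (j + k)
        = (- 1) ^ k * (fact n / fact (n - k)) * pochhammer (- real (n - k)) j"
      using k pochhammer_product'[of "- real n" k j] by (simp add: of_nat_diff add_ac)
    have r: "rGamma (real k + 1 + real j) = inverse (fact (j + k))"
      using Gamma_fact[of "j + k", where ?'a = real] by (simp add: rGamma_inverse_Gamma add_ac)
    have e: "norm_power (- real k + real (j + k)) y = y ^ j / fact j"
      using y Gamma_fact[of j, where ?'a = real]
      by (simp add: norm_power_def rGamma_inverse_Gamma powr_realpow add_ac field_simps)
    have s: "(- 2 * lam) ^ k = (- 1) ^ k * (2 * lam) ^ k"
      by (subst power_mult_distrib[symmetric]) simp
    show "?t (j + k) = (- 2 * lam) ^ k * (fact n / fact (n - k) *
      (pochhammer (- real (n - k)) j * (2 * lam * y) ^ j / fact j * rGamma (real k + 1 + real j)))"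
      unfolding laguerre_coeff_def e p r s power_mult_distrib[of "2 * lam" y] power_add
      by (simp add: field_simps)
  qed
  also have "\<dots> = (- 2 * lam) ^ k * Laguerre (n - k) (real k) (2 * lam * y)"
  proof -
    have "Gamma (real (n - k) + 1 + real k) = fact n"
      using k Gamma_fact[of n, where ?'a = real] by (simp add: of_nat_diff add_ac)
    then show ?thesis
      by (simp add: Laguerre_eq_sum sum_distrib_left)
  qed
  finally show ?thesis by (simp add: power_sum_def)
qed

section \<open>Tempered operators on Laguerre functions\<close>

theorem lemma1:
  fixes \<mu> \<nu> lam x :: real and n :: nat
  assumes "\<mu> \<ge> 0" and "\<nu> \<ge> 0" and "lam > 0" and "x > 0"
  shows
    "(tempered_integrable \<mu> lam (GLF n (- \<nu>) lam) x \<and>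
      tempered_integral \<mu> lam (GLF n (- \<nu>) lam) x
        = h_coeff n \<nu> (- \<mu>) * GLF n (- \<nu> - \<mu>) lam x)
     \<and> (\<nu> \<ge> \<mu> \<longrightarrow>
          tempered_differentiable \<mu> lam (GLF n (- \<nu>) lam) \<and>
          tempered_deriv \<mu> lam (GLF n (- \<nu>) lam) x
            = h_coeff n \<nu> \<mu> * GLF n (\<mu> - \<nu>) lam x)
     \<and> (\<forall>k::nat. n \<ge> k \<longrightarrow>
          tempered_differentiable (\<mu> + real k) lam (GLF n (- \<mu>) lam) \<and>
          tempered_deriv (\<mu> + real k) lam (GLF n (- \<mu>) lam) x
            = (- 2 * lam) ^ k * h_coeff n \<mu> \<mu> * GLF (n - k) (real k) lam x)"
proof -
  let ?c = "laguerre_coeff n lam"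
  define pre where "pre a = Gamma (real n + 1 + a) / fact n" for a
  have u: "exp (lam * y) * GLF n (- a) lam y = power_sum n (\<lambda>i. pre a * ?c i) a y"
    if "a \<ge> 0" "y > 0" for a y
    unfolding power_sum_scale pre_def by (rule exp_times_GLF[OF that])
  have pre_nz: "pre a \<noteq> 0" if "a \<ge> 0" for a
  proof -
    have "Gamma (real n + 1 + a) > 0"
      using that by (intro Gamma_real_pos) simp
    then show ?thesis by (simp add: pre_def)
  qed
  have GLF_back: "exp (- lam * x) * power_sum n ?c a x = GLF n (- a) lam x / pre a"
    if "a \<ge> 0" for a
    using u[OF that \<open>x > 0\<close>] pre_nz[OF that]
    by (simp add: power_sum_scale exp_minus field_simps)
  have h: "h_coeff n a b = pre a / pre (a - b)" for a b
    by (simp add: h_coeff_def pre_def add_diff_eq)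
  note I = RL_integral_power_sum[OF u[OF \<open>\<nu> \<ge> 0\<close>] \<open>\<mu> \<ge> 0\<close> _ \<open>x > 0\<close>, simplified power_sum_scale]
  note D = RL_deriv_power_sum[OF u, simplified power_sum_scale]
  have "tempered_integrable \<mu> lam (GLF n (- \<nu>) lam) x"
    using I(1) assms by (simp add: tempered_integrable_def)
  moreover have "tempered_integral \<mu> lam (GLF n (- \<nu>) lam) x
      = h_coeff n \<nu> (- \<mu>) * GLF n (- \<nu> - \<mu>) lam x"
  proof -
    have "tempered_integral \<mu> lam (GLF n (- \<nu>) lam) x
        = pre \<nu> * (exp (- lam * x) * power_sum n ?c (\<nu> + \<mu>) x)"
      using I(2) assms by (simp add: tempered_integral_def)
    also have "\<dots> = pre \<nu> * (GLF n (- (\<nu> + \<mu>)) lam x / pre (\<nu> + \<mu>))"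
      using assms by (subst GLF_back) auto
    finally show ?thesis by (simp add: h)
  qed
  moreover have "tempered_differentiable m lam (GLF n (- a) lam)" if "a \<ge> 0" for m a
    using D(1)[OF that] that by (simp add: tempered_differentiable_def)
  moreover have "tempered_deriv m lam (GLF n (- a) lam) x
      = pre a * (exp (- lam * x) * power_sum n ?c (a - m) x)" if "a \<ge> 0" for m a
    using D(2)[OF that] that \<open>x > 0\<close> by (simp add: tempered_deriv_def)
  moreover have "pre \<nu> * (exp (- lam * x) * power_sum n ?c (\<nu> - \<mu>) x)
      = h_coeff n \<nu> \<mu> * GLF n (\<mu> - \<nu>) lam x" if "\<nu> \<ge> \<mu>"
    using that by (subst GLF_back) (auto simp: h)
  moreover have "pre \<mu> * (exp (- lam * x) * power_sum n ?c (\<mu> - (\<mu> + real k)) x)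
      = (- 2 * lam) ^ k * h_coeff n \<mu> \<mu> * GLF (n - k) (real k) lam x" if "n \<ge> k" for k
  proof -
    have "pre 0 = 1"
      using Gamma_fact[of n, where ?'a = real] by (simp add: pre_def add_ac)
    then show ?thesis
      using laguerre_sum_negative_exponent[OF that \<open>x > 0\<close>, of lam]
      by (simp add: h GLF_def mult_ac)
  qed
  ultimately show ?thesis using assms by simp
qed

end
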